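(* Let $\mathbf p=(p_0,p_1,p_2,\dots)$ be any offspring distribution, and consider the normal, misère and escape games played on the Galton-Watson tree with offspring distribution $\mathbf p$, started at the root. Let $G(x)=\sum_{i\ge 0}p_ix^i$, $F(x)=1-G(x)$ and $H(x)=1-G(x)+p_0$ for $x\in[0,1]$, and for a function $f$ on $[0,1]$ let $\mathsf{FP}(f)=\{x\in[0,1]: f(x)=x\}$. Write $F^2=F\circ F$ and $H^2=H\circ H$. Then: (i) $D=\max \mathsf{FP}(F^2)-\min \mathsf{FP}(F^2)$, $\;N=\min \mathsf{FP}(F^2)$, $\;P=1-\max\mathsf{FP}(F^2)$; (ii) $\widetilde D=\max \mathsf{FP}(H^2)-\min \mathsf{FP}(H^2)$, $\;\widetilde N=\min \mathsf{FP}(H^2)$, $\;\widetilde P=1-\max\mathsf{FP}(H^2)$; (iii) $E^{(1)}=\max \mathsf{FP}(F\circ H)$, $\;E^{(2)}=1-\min\mathsf{FP}(H\circ F)$.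
   Context: An offspring distribution is a probability mass function $\mathbf p=(p_0,p_1,\dots)$ on $\{0,1,2,\dots\}$. Let $\mathcal T$ be the Galton-Watson tree with offspring distribution $\mathbf p$, with edges directed from parents to children and root $o$. A token starts at $o$, and two players alternately move the token along a directed edge to a child of its current vertex. The tree is fully known to both players. A strategy for a player assigns to every vertex that has a child a legal move; it is winning if it yields a win for that player whatever strategy the opponent uses. Normal game: a player who cannot move loses and the other wins. Misère game: a player who cannot move wins and the other loses. In both, the game is a win for a player who has a winning strategy, and a draw if neither player has a winning strategy. Escape game: the players are Stopper and Escaper; Stopper wins if either player is ever unable to move; the game is a win for Escaper if Stopper has no winning strategy. $N$, $P$, $D=1-N-P$ are the probabilities (over $\mathcal T$) that the normal game is a win for the player moving first (Next), a win for the player moving second (Previous), a draw, respectively. $\widetilde N,\widetilde P,\widetilde D$ are the analogous probabilities for the misère game. $S^{(1)}$ (resp. $S^{(2)}$) is the probability that Stopper wins the escape game when Stopper moves first (resp. second). $E^{(1)}=1-S^{(2)}$ and $E^{(2)}=1-S^{(1)}$ are the win probabilities for Escaper when Escaper moves first or second respectively. *)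

theory Defs
  imports "HOL-Probability.Probability"
begin

section \<open>Galton-Watson trees\<close>

text \<open>
  Ulam-Harris encoding: a vertex is the list of child indices on the path from the root
  \<open>[]\<close>, and \<open>\<omega> v\<close> is the number of children of \<open>v\<close>, whose children are \<open>v @ [i]\<close> for
  \<open>i < \<omega> v\<close>. The values of \<open>\<omega>\<close> at lists that are not vertices of the tree are irrelevant.
\<close>

type_synonym vertex = "nat list"

definition gw_tree :: "(vertex \<Rightarrow> nat) \<Rightarrow> vertex set" where
  "gw_tree \<omega> = {v. \<forall>k < length v. v ! k < \<omega> (take k v)}"

definition gw_space :: "nat pmf \<Rightarrow> (vertex \<Rightarrow> nat) measure" where
  "gw_space p = (\<Pi>\<^sub>M v\<in>UNIV. measure_pmf p)"

definition gw_prob :: "nat pmf \<Rightarrow> (vertex set \<Rightarrow> bool) \<Rightarrow> real" where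
  "gw_prob p Q = measure (gw_space p) {\<omega> \<in> space (gw_space p). Q (gw_tree \<omega>)}"

section \<open>Games on a tree\<close>

definition children :: "vertex set \<Rightarrow> vertex \<Rightarrow> vertex set" where
  "children T v = {w \<in> T. \<exists>i. w = v @ [i]}"

type_synonym strategy = "vertex \<Rightarrow> vertex"

definition is_strategy :: "vertex set \<Rightarrow> strategy \<Rightarrow> bool" where
  "is_strategy T s \<longleftrightarrow> (\<forall>v\<in>T. children T v \<noteq> {} \<longrightarrow> s v \<in> children T v)"

datatype player = First | Second

definition mover :: "nat \<Rightarrow> player" where
  "mover n = (if even n then First else Second)"

text \<open>
  Position of the token after \<open>n\<close> moves when the first mover uses \<open>s\<close> and the second
  mover uses \<open>t\<close>; it is \<open>None\<close> if the game ended after fewer than \<open>n\<close> moves.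
\<close>

primrec play :: "vertex set \<Rightarrow> strategy \<Rightarrow> strategy \<Rightarrow> nat \<Rightarrow> vertex option" where
  "play T s t 0 = Some []"
| "play T s t (Suc n) =
    (case play T s t n of
       None \<Rightarrow> None
     | Some v \<Rightarrow>
         if children T v = {} then None
         else Some (case mover n of First \<Rightarrow> s v | Second \<Rightarrow> t v))"

definition stuck :: "vertex set \<Rightarrow> strategy \<Rightarrow> strategy \<Rightarrow> player \<Rightarrow> bool" where
  "stuck T s t a \<longleftrightarrow> (\<exists>n v. play T s t n = Some v \<and> children T v = {} \<and> mover n = a)"

text \<open>
  A winning condition \<open>W T s t\<close> says that the play of \<open>s\<close> (first mover) against \<open>t\<close>
  (second mover) is a win for the player under consideration.
\<close>

type_synonym win_cond = "vertex set \<Rightarrow> strategy \<Rightarrow> strategy \<Rightarrow> bool"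

definition first_can_force :: "win_cond \<Rightarrow> vertex set \<Rightarrow> bool" where
  "first_can_force W T \<longleftrightarrow>
     (\<exists>s. is_strategy T s \<and> (\<forall>t. is_strategy T t \<longrightarrow> W T s t))"

definition second_can_force :: "win_cond \<Rightarrow> vertex set \<Rightarrow> bool" where
  "second_can_force W T \<longleftrightarrow>
     (\<exists>t. is_strategy T t \<and> (\<forall>s. is_strategy T s \<longrightarrow> W T s t))"

subsection \<open>Normal game\<close>

definition normal_next :: "vertex set \<Rightarrow> bool" where
  "normal_next = first_can_force (\<lambda>T s t. stuck T s t Second)"

definition normal_previous :: "vertex set \<Rightarrow> bool" where
  "normal_previous = second_can_force (\<lambda>T s t. stuck T s t First)"

definition normal_draw :: "vertex set \<Rightarrow> bool" where
  "normal_draw T \<longleftrightarrow> \<not> normal_next T \<and> \<not> normal_previous T"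

subsection \<open>Misere game\<close>

definition misere_next :: "vertex set \<Rightarrow> bool" where
  "misere_next = first_can_force (\<lambda>T s t. stuck T s t First)"

definition misere_previous :: "vertex set \<Rightarrow> bool" where
  "misere_previous = second_can_force (\<lambda>T s t. stuck T s t Second)"

definition misere_draw :: "vertex set \<Rightarrow> bool" where
  "misere_draw T \<longleftrightarrow> \<not> misere_next T \<and> \<not> misere_previous T"

subsection \<open>Escape game\<close>

definition stopper_wins_first :: "vertex set \<Rightarrow> bool" where
  "stopper_wins_first = first_can_force (\<lambda>T s t. \<exists>a. stuck T s t a)"

definition stopper_wins_second :: "vertex set \<Rightarrow> bool" where
  "stopper_wins_second = second_can_force (\<lambda>T s t. \<exists>a. stuck T s t a)"

section \<open>Outcome probabilities\<close>

definition prob_N :: "nat pmf \<Rightarrow> real" where "prob_N p = gw_prob p normal_next"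
definition prob_P :: "nat pmf \<Rightarrow> real" where "prob_P p = gw_prob p normal_previous"
definition prob_D :: "nat pmf \<Rightarrow> real" where "prob_D p = gw_prob p normal_draw"

definition misere_N :: "nat pmf \<Rightarrow> real" where "misere_N p = gw_prob p misere_next"
definition misere_P :: "nat pmf \<Rightarrow> real" where "misere_P p = gw_prob p misere_previous"
definition misere_D :: "nat pmf \<Rightarrow> real" where "misere_D p = gw_prob p misere_draw"

definition stopper_S1 :: "nat pmf \<Rightarrow> real" where "stopper_S1 p = gw_prob p stopper_wins_first"
definition stopper_S2 :: "nat pmf \<Rightarrow> real" where "stopper_S2 p = gw_prob p stopper_wins_second"

text \<open>When Escaper moves first, Stopper moves second, and vice versa.\<close>

definition escaper_E1 :: "nat pmf \<Rightarrow> real" where "escaper_E1 p = 1 - stopper_S2 p"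
definition escaper_E2 :: "nat pmf \<Rightarrow> real" where "escaper_E2 p = 1 - stopper_S1 p"

section \<open>Generating function and fixed points\<close>

definition gen_G :: "nat pmf \<Rightarrow> real \<Rightarrow> real" where
  "gen_G p x = (\<Sum>i. pmf p i * x ^ i)"

definition fun_F :: "nat pmf \<Rightarrow> real \<Rightarrow> real" where
  "fun_F p x = 1 - gen_G p x"

definition fun_H :: "nat pmf \<Rightarrow> real \<Rightarrow> real" where
  "fun_H p x = 1 - gen_G p x + pmf p 0"

definition FP :: "(real \<Rightarrow> real) \<Rightarrow> real set" where
  "FP f = {x \<in> {0..1}. f x = x}"

text \<open>
  These sets of fixed points may be infinite (if every vertex has exactly one child, then
  \<open>F \<circ> F\<close> is the identity), so \<open>Max\<close> and \<open>Min\<close>, which are meant for finite sets, do not apply.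
\<close>

definition max_FP :: "(real \<Rightarrow> real) \<Rightarrow> real" where
  "max_FP f = (GREATEST x. x \<in> FP f)"

definition min_FP :: "(real \<Rightarrow> real) \<Rightarrow> real" where
  "min_FP f = (LEAST x. x \<in> FP f)"

end

theory Submission
  imports Defs
begin

text \<open>
  A win for a player is a least fixed point: the player wins from a vertex with moves to make
  iff some child (on the player's own turn) or every child (on the opponent's turn) is won.
  As the tree is locally finite, this fixed point is reached after \<open>\<omega>\<close> steps, so the
  event that the player can force a win is the increasing union of the events of a win within \<open>n\<close> moves. The subtrees at the
  children of the root are independent copies of the tree, so if \<open>m\<close> is the winning probability
  when the player moves first and \<open>1 - q\<close> that when the player moves second, then \<open>m = A q\<close> and
  \<open>q = B m\<close>, where \<open>A\<close> is \<open>H\<close> or \<open>F\<close> according to whether the player wins when stuck on their own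
  turn, and \<open>B\<close> is \<open>F\<close> or \<open>H\<close> according to whether they win when the opponent is stuck. The
  same recursion started from \<open>m = 0\<close>, \<open>q = 1\<close> gives the probabilities of winning within \<open>n\<close>
  moves. Since \<open>A\<close> and \<open>B\<close> are antitone, every such \<open>m\<close> is below all fixed points
  of \<open>A \<circ> B\<close> and every such \<open>q\<close> above all fixed points of \<open>B \<circ> A\<close>. Passing to the limit uses only continuity of measure, not
  continuity of \<open>G\<close>.
\<close>

section \<open>Determinacy\<close>

text \<open>The labelling below child \<open>[i]\<close>, rerooted at \<open>[]\<close>. It is
  defined even when \<open>i\<close> is not a child, so it is a total map and has the same law as
  \<open>\<omega>\<close>.\<close>

definition subtree :: "nat \<Rightarrow> (vertex \<Rightarrow> nat) \<Rightarrow> vertex \<Rightarrow> nat" where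
  "subtree i \<omega> = (\<lambda>w. \<omega> (i # w))"

text \<open>
  A fixed player forces a win in fewer than \<open>n\<close> moves: \<open>own\<close> tells whether the root is this
  player's turn, and \<open>W True\<close> (\<open>W False\<close>) whether this player wins when stuck on their own (the
  opponent's) turn.
\<close>

primrec forces :: "(bool \<Rightarrow> bool) \<Rightarrow> bool \<Rightarrow> nat \<Rightarrow> (vertex \<Rightarrow> nat) \<Rightarrow> bool" where
  "forces W own 0 \<omega> = False"
| "forces W own (Suc n) \<omega> =
    (if \<omega> [] = 0 then W own
     else if own then \<exists>i<\<omega> []. forces W False n (subtree i \<omega>)
     else \<forall>i<\<omega> []. forces W True n (subtree i \<omega>))"

definition wins :: "(bool \<Rightarrow> bool) \<Rightarrow> bool \<Rightarrow> (vertex \<Rightarrow> nat) \<Rightarrow> bool" where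
  "wins W own \<omega> \<longleftrightarrow> (\<exists>n. forces W own n \<omega>)"

lemma forces_mono: "forces W own m \<omega> \<Longrightarrow> m \<le> n \<Longrightarrow> forces W own n \<omega>"
proof (induction m arbitrary: own \<omega> n)
  case (Suc m)
  then obtain n' where "n = Suc n'" "m \<le> n'"
    by (metis Suc_le_D Suc_le_mono)
  with Suc show ?case
    by (auto split: if_splits)
qed simp

text \<open>The delicate case is the opponent's turn: each child comes with its own bound, and
  because there are only finitely many children, \<open>forces_mono\<close> lifts all of them to
  their maximum.\<close>

lemma wins_iff:
  "wins W own \<omega> \<longleftrightarrow>
    (if \<omega> [] = 0 then W own
     else if own then \<exists>i<\<omega> []. wins W False (subtree i \<omega>)
     else \<forall>i<\<omega> []. wins W True (subtree i \<omega>))" (is "_ \<longleftrightarrow> ?R")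
proof
  assume "wins W own \<omega>"
  then obtain n where n: "forces W own n \<omega>"
    by (auto simp: wins_def)
  then obtain m where "n = Suc m"
    by (cases n) auto
  with n show ?R
    by (auto simp: wins_def split: if_splits)
next
  assume R: ?R
  show "wins W own \<omega>"
  proof (cases "own \<or> \<omega> [] = 0")
    case True
    show ?thesis
    proof (cases "\<omega> [] = 0")
      case True
      with R have "forces W own (Suc 0) \<omega>" by simp
      then show ?thesis unfolding wins_def by blast
    next
      case False
      with R True obtain i n where "i < \<omega> []" "forces W False n (subtree i \<omega>)"
        by (auto simp: wins_def)
      with False True have "forces W own (Suc n) \<omega>" by auto
      then show ?thesis unfolding wins_def by blast
    qed
  next
    case False
    with R have "\<forall>i<\<omega> []. \<exists>n. forces W True n (subtree i \<omega>)"
      by (auto simp: wins_def)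
    then obtain f where f: "\<And>i. i < \<omega> [] \<Longrightarrow> forces W True (f i) (subtree i \<omega>)"
      by metis
    have "forces W True (Max (f ` {..<\<omega> []})) (subtree i \<omega>)" if "i < \<omega> []" for i
      using f[OF that] that by (auto intro: forces_mono)
    with False have "forces W own (Suc (Max (f ` {..<\<omega> []}))) \<omega>" by simp
    then show ?thesis unfolding wins_def by blast
  qed
qed

section \<open>Plays and strategies on the tree\<close>

lemma Nil_in_gw_tree: "[] \<in> gw_tree \<omega>"
  by (simp add: gw_tree_def)

lemma snoc_in_gw_tree_iff: "v @ [i] \<in> gw_tree \<omega> \<longleftrightarrow> v \<in> gw_tree \<omega> \<and> i < \<omega> v"
  by (auto simp: gw_tree_def nth_append less_Suc_eq)

lemma children_gw_tree: "v \<in> gw_tree \<omega> \<Longrightarrow> children (gw_tree \<omega>) v = (\<lambda>i. v @ [i]) ` {..<\<omega> v}"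
  by (auto simp: children_def snoc_in_gw_tree_iff)

text \<open>
  Here \<open>x\<close> is the forcing player and \<open>A\<close> the set of players whose being stuck is a win for \<open>x\<close>.
\<close>

definition can_force :: "player \<Rightarrow> player set \<Rightarrow> vertex set \<Rightarrow> bool" where
  "can_force x A T \<longleftrightarrow>
    (\<exists>\<sigma>. is_strategy T \<sigma> \<and> (\<forall>\<tau>. is_strategy T \<tau> \<longrightarrow>
      (\<exists>a\<in>A. if x = First then stuck T \<sigma> \<tau> a else stuck T \<tau> \<sigma> a)))"

lemma mover_Suc_iff: "mover (Suc k) = x \<longleftrightarrow> mover k \<noteq> x"
  by (cases x) (auto simp: mover_def)

lemma play_length:
  assumes "is_strategy (gw_tree \<omega>) s" "is_strategy (gw_tree \<omega>) t"
  shows "play (gw_tree \<omega>) s t k = Some v \<Longrightarrow> v \<in> gw_tree \<omega> \<and> length v = k"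
proof (induction k arbitrary: v)
  case 0
  then show ?case by (simp add: Nil_in_gw_tree)
next
  case (Suc k)
  let ?T = "gw_tree \<omega>"
  from Suc.prems obtain u where u: "play ?T s t k = Some u" "children ?T u \<noteq> {}"
      and v: "v = (case mover k of First \<Rightarrow> s u | Second \<Rightarrow> t u)"
    by (auto split: option.splits if_splits)
  from Suc.IH[OF u(1)] assms u(2) v have "v \<in> children ?T u" "length u = k"
    by (auto simp: is_strategy_def split: player.splits)
  then show ?case
    by (auto simp: children_def)
qed

text \<open>Two explicit strategies. If \<open>wins\<close> holds, \<open>x\<close> moves so that
  the remaining bound drops; if it fails, the opponent keeps the token where it fails. The premise
  on \<open>W\<close> translates absolute players into turns relative to \<open>x\<close>.\<close>

lemma can_force_iff:
  assumes W: "\<And>a. W (a = x) \<longleftrightarrow> a \<in> A"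
  shows "can_force x A (gw_tree \<omega>) \<longleftrightarrow> wins W (x = First) \<omega>"
proof -
  let ?T = "gw_tree \<omega>"
  \<comment> \<open>The depth of a vertex determines whose turn it is there.\<close>
  let ?own = "\<lambda>v. mover (length v) = x"
  let ?sub = "\<lambda>v w. \<omega> (v @ w)"
  let ?C = "\<lambda>v. children ?T v"
  \<comment> \<open>\<open>\<sigma>\<close> always belongs to \<open>x\<close> and
    \<open>\<tau>\<close> to the opponent, so one argument covers both seats.\<close>
  let ?play = "\<lambda>\<sigma> \<tau>. if x = First then play ?T \<sigma> \<tau> else play ?T \<tau> \<sigma>"
  have play_Suc: "?play \<sigma> \<tau> (Suc k) = Some (if ?own v then \<sigma> v else \<tau> v)"
    if "?play \<sigma> \<tau> k = Some v" "?C v \<noteq> {}" "length v = k" for \<sigma> \<tau> k v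
    using that by (cases x) (auto split: player.splits)
  have play_D: "?C v \<noteq> {} \<and> w = (if mover k = x then \<sigma> v else \<tau> v)"
    if "?play \<sigma> \<tau> (Suc k) = Some w" "?play \<sigma> \<tau> k = Some v" for \<sigma> \<tau> k v w
    using that by (cases x) (auto split: player.splits if_splits)
  have play_prev: "\<exists>v. ?play \<sigma> \<tau> k = Some v" if "?play \<sigma> \<tau> (Suc k) = Some w" for \<sigma> \<tau> k w
    using that by (auto split: if_splits option.splits)
  have stuck_iff: "(if x = First then stuck ?T \<sigma> \<tau> a else stuck ?T \<tau> \<sigma> a) \<longleftrightarrow>
      (\<exists>n v. ?play \<sigma> \<tau> n = Some v \<and> ?C v = {} \<and> mover n = a)" for \<sigma> \<tau> a
    by (simp add: stuck_def)
  have play_len: "v \<in> ?T \<and> length v = k"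
    if "is_strategy ?T \<sigma>" "is_strategy ?T \<tau>" "?play \<sigma> \<tau> k = Some v" for \<sigma> \<tau> k v
    using that play_length by (auto split: if_splits)
  have own0: "x = First \<longleftrightarrow> mover 0 = x"
    by (auto simp: mover_def)
  show ?thesis
  proof
    assume win: "wins W (x = First) \<omega>"
    \<comment> \<open>Moving to an arbitrary won child could postpone the end forever, so the move
      must lower the bound. All \<open>n\<close> are covered at once because a positional strategy
      fixes its move in advance of any bound.\<close>
    define good where "good v w \<longleftrightarrow> w \<in> ?C v \<and>
      (\<forall>n. forces W True (Suc n) (?sub v) \<longrightarrow> forces W False n (?sub w))" for v w
    have good_ex: "\<exists>w. good v w" if v: "v \<in> ?T" "?C v \<noteq> {}" "wins W True (?sub v)" for v
    proof -
      \<comment> \<open>A child that witnesses the least bound also serves every larger one, by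
        \<open>forces_mono\<close>.\<close>
      define r where "r = (LEAST n. forces W True n (?sub v))"
      have r: "forces W True r (?sub v)" "\<And>n. forces W True n (?sub v) \<Longrightarrow> r \<le> n"
        using v(3) unfolding wins_def r_def by (auto intro: LeastI_ex Least_le)
      then obtain m where m: "r = Suc m"
        by (cases r) auto
      with r(1) v obtain i where "i < \<omega> v" "forces W False m (?sub (v @ [i]))"
        by (auto simp: children_gw_tree subtree_def split: if_splits)
      moreover have "forces W False n (?sub (v @ [i]))" if "forces W True (Suc n) (?sub v)" for n
        using r(2)[OF that] m forces_mono[OF \<open>forces W False m (?sub (v @ [i]))\<close>, of n] by simp
      ultimately have "good v (v @ [i])"
        using v(1) unfolding good_def by (simp add: children_gw_tree)
      then show ?thesis by blast
    qed
    \<comment> \<open>Off the won vertices any child will do, just to keep \<open>\<sigma>\<close>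
      legal. The test treats \<open>v\<close> as a turn of \<open>x\<close>; \<open>reach\<close>
      consults it only there.\<close>
    define \<sigma> where "\<sigma> v = (if wins W True (?sub v) then (SOME w. good v w) else (SOME w. w \<in> ?C v))" for v
    have \<sigma>_good: "good v (\<sigma> v)" if "v \<in> ?T" "?C v \<noteq> {}" "wins W True (?sub v)" for v
      using someI_ex[OF good_ex[OF that]] that by (simp add: \<sigma>_def)
    have \<sigma>: "is_strategy ?T \<sigma>"
      unfolding is_strategy_def
    proof (intro ballI impI)
      fix v assume v: "v \<in> ?T" "?C v \<noteq> {}"
      show "\<sigma> v \<in> ?C v"
      proof (cases "wins W True (?sub v)")
        case True
        with \<sigma>_good[OF v] show ?thesis by (simp add: good_def)
      next
        case False
        with v(2) show ?thesis by (simp add: \<sigma>_def some_in_eq)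
      qed
    qed
    \<comment> \<open>Induction on the bound: each move uses up one unit and bound 0 is impossible,
      so the play gets stuck in time, at a vertex that \<open>W\<close> counts as a win.\<close>
    have reach: "\<exists>m u. ?play \<sigma> \<tau> m = Some u \<and> ?C u = {} \<and> mover m \<in> A"
      if \<tau>: "is_strategy ?T \<tau>" and "forces W (?own v) n (?sub v)" "?play \<sigma> \<tau> k = Some v"
      for \<tau> n k v
      using that(2,3)
    proof (induction n arbitrary: k v)
      case (Suc n)
      from play_len[OF \<sigma> \<tau> Suc.prems(2)] have v: "v \<in> ?T" and k: "length v = k" by auto
      show ?case
      proof (cases "?C v = {}")
        case True
        with v have "\<omega> v = 0" by (simp add: children_gw_tree lessThan_empty_iff)
        with Suc.prems(1) k W[of "mover k"] have "mover k \<in> A" by simp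
        with True Suc.prems(2) show ?thesis by blast
      next
        case False
        with v have \<omega>v: "\<omega> v \<noteq> 0" by (auto simp: children_gw_tree)
        define w where "w = (if ?own v then \<sigma> v else \<tau> v)"
        have pw: "?play \<sigma> \<tau> (Suc k) = Some w"
          unfolding w_def by (rule play_Suc[OF Suc.prems(2) False k])
        have wl: "length w = Suc k"
          using play_len[OF \<sigma> \<tau> pw] by simp
        have "forces W (?own w) n (?sub w)"
        proof (cases "?own v")
          case True
          with Suc.prems(1) have f: "forces W True (Suc n) (?sub v)"
            by (simp only: simp_thms)
          then have "wins W True (?sub v)"
            unfolding wins_def by (rule exI)
          from \<sigma>_good[OF v False this] f have "forces W False n (?sub (\<sigma> v))"
            unfolding good_def by blast
          moreover have "\<not> ?own w"
            using True wl k by (simp add: mover_Suc_iff)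
          ultimately show ?thesis
            using True by (simp add: w_def)
        next
          case own: False
          with \<tau> v False have "w \<in> ?C v" by (simp add: is_strategy_def w_def)
          then obtain i where i: "i < \<omega> v" "w = v @ [i]"
            using v by (auto simp: children_gw_tree)
          with own Suc.prems(1) \<omega>v wl have "forces W True n (?sub w)"
            by (simp add: subtree_def)
          with own wl k show ?thesis by (simp add: mover_Suc_iff)
        qed
        from Suc.IH[OF this pw] show ?thesis .
      qed
    qed simp
    show "can_force x A ?T"
      unfolding can_force_def
    proof (intro exI[of _ \<sigma>] conjI allI impI \<sigma>)
      fix \<tau> assume \<tau>: "is_strategy ?T \<tau>"
      from win obtain n where "forces W (?own []) n (?sub [])"
        unfolding wins_def using own0 by auto
      with reach[OF \<tau>, of "[]" n 0] have "\<exists>m u. ?play \<sigma> \<tau> m = Some u \<and> ?C u = {} \<and> mover m \<in> A"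
        by simp
      then show "\<exists>a\<in>A. if x = First then stuck ?T \<sigma> \<tau> a else stuck ?T \<tau> \<sigma> a"
        unfolding stuck_iff by blast
    qed
  next
    assume force: "can_force x A ?T"
    show "wins W (x = First) \<omega>"
    proof (rule ccontr)
      assume lose: "\<not> wins W (x = First) \<omega>"
      from force obtain \<sigma> where \<sigma>: "is_strategy ?T \<sigma>"
        and \<sigma>_wins: "\<And>\<tau>. is_strategy ?T \<tau> \<Longrightarrow>
          \<exists>a\<in>A. if x = First then stuck ?T \<sigma> \<tau> a else stuck ?T \<tau> \<sigma> a"
        unfolding can_force_def by blast
      \<comment> \<open>Where \<open>wins W False\<close> already holds there is nothing to defend,
        and any child is accepted.\<close>
      define bad where "bad v w \<longleftrightarrow>
        w \<in> ?C v \<and> (\<not> wins W False (?sub v) \<longrightarrow> \<not> wins W True (?sub w))" for v w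
      have bad_ex: "\<exists>w. bad v w" if v: "v \<in> ?T" "?C v \<noteq> {}" for v
      proof (cases "wins W False (?sub v)")
        case True
        with v show ?thesis by (auto simp: bad_def)
      next
        case False
        with v obtain i where "i < \<omega> v" "\<not> wins W True (?sub (v @ [i]))"
          by (subst (asm) wins_iff) (auto simp: children_gw_tree subtree_def)
        with v have "bad v (v @ [i])"
          by (auto simp: bad_def children_gw_tree)
        then show ?thesis by blast
      qed
      define \<tau> where "\<tau> v = (SOME w. bad v w)" for v
      have \<tau>_bad: "bad v (\<tau> v)" if "v \<in> ?T" "?C v \<noteq> {}" for v
        using someI_ex[OF bad_ex[OF that]] by (simp add: \<tau>_def)
      have \<tau>: "is_strategy ?T \<tau>"
        using \<tau>_bad by (simp add: is_strategy_def bad_def)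
      \<comment> \<open>The play never enters the won region: on a turn of \<open>x\<close> no child
        is won, and on the opponent's turn \<open>\<tau>\<close> avoids the won children.\<close>
      have inv: "\<not> wins W (?own v) (?sub v)" if "?play \<sigma> \<tau> k = Some v" for k v
        using that
      proof (induction k arbitrary: v)
        case 0
        then have "v = []" by (simp split: if_splits)
        with lose own0 show ?case by simp
      next
        case (Suc k)
        obtain u where u: "?play \<sigma> \<tau> k = Some u"
          using play_prev[OF Suc.prems] by blast
        from play_len[OF \<sigma> \<tau> u] have uT: "u \<in> ?T" "length u = k" by auto
        from play_D[OF Suc.prems u] have Cu: "?C u \<noteq> {}"
          and v: "v = (if mover k = x then \<sigma> u else \<tau> u)" by auto
        have vl: "length v = Suc k"
          using play_len[OF \<sigma> \<tau> Suc.prems] by simp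
        have lu: "\<not> wins W (?own u) (?sub u)"
          by (rule Suc.IH[OF u])
        show ?case
        proof (cases "mover k = x")
          case True
          with \<sigma> uT Cu v have "v \<in> ?C u" by (simp add: is_strategy_def)
          then obtain i where i: "i < \<omega> u" "v = u @ [i]"
            using uT by (auto simp: children_gw_tree)
          have "\<not> wins W False (?sub v)"
            using lu True i uT
            by (subst (asm) wins_iff) (auto simp: subtree_def)
          with True vl show ?thesis by (simp add: mover_Suc_iff)
        next
          case False
          with \<tau>_bad[OF uT(1) Cu] lu v uT vl show ?thesis
            by (simp add: bad_def mover_Suc_iff)
        qed
      qed
      \<comment> \<open>A vertex without children whose mover lies in \<open>A\<close> satisfies
        \<open>wins\<close> outright, against \<open>inv\<close>.\<close>
      from \<sigma>_wins[OF \<tau>] obtain k v where k: "?play \<sigma> \<tau> k = Some v" "?C v = {}" "mover k \<in> A"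
        unfolding stuck_iff by blast
      from play_len[OF \<sigma> \<tau> k(1)] k(2) have "\<omega> v = 0" "length v = k"
        by (auto simp: children_gw_tree lessThan_empty_iff)
      with inv[OF k(1)] k(3) W[of "mover k"] show False
        by (subst (asm) wins_iff) simp
    qed
  qed
qed

text \<open>From one move after a dead end on, the play is \<open>None\<close>, so it has at most
  one dead end. This makes the wins of the two players exclusive.\<close>

lemma stuck_unique:
  assumes "stuck T s t a" "stuck T s t b"
  shows "a = b"
proof -
  have aux: "play T s t n = None" if "play T s t m = Some v" "children T v = {}" "Suc m \<le> n" for m n v
    using that(3) by (induction rule: dec_induct) (use that in auto)
  show ?thesis
    using assms aux unfolding stuck_def by (metis Suc_leI linorder_neqE_nat option.distinct(1))
qed

section \<open>Branching recursion for probabilities\<close>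

abbreviation gw_P :: "nat pmf \<Rightarrow> ((vertex \<Rightarrow> nat) \<Rightarrow> bool) \<Rightarrow> real" where
  "gw_P p B \<equiv> measure (gw_space p) {\<omega>. B \<omega>}"

lemma space_gw_space [simp]: "space (gw_space p) = UNIV"
  by (simp add: gw_space_def space_PiM)

lemma prob_space_gw_space: "prob_space (gw_space p)"
  unfolding gw_space_def by (intro prob_space_PiM measure_pmf.prob_space_axioms)

lemma measurable_eval [measurable]: "(\<lambda>\<omega>. \<omega> v) \<in> gw_space p \<rightarrow>\<^sub>M count_space UNIV"
proof -
  have "(\<lambda>\<omega>. \<omega> v) \<in> gw_space p \<rightarrow>\<^sub>M measure_pmf p"
    unfolding gw_space_def by (rule measurable_component_singleton) simp
  then show ?thesis by (simp cong: measurable_cong_sets)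
qed

lemma measurable_subtree [measurable]: "subtree i \<in> gw_space p \<rightarrow>\<^sub>M gw_space p"
proof -
  have "(\<lambda>\<omega> w. \<omega> (i # w)) \<in> gw_space p \<rightarrow>\<^sub>M (\<Pi>\<^sub>M v\<in>UNIV. measure_pmf p)"
    by (rule measurable_PiM_single') (simp_all cong: measurable_cong_sets)
  then show ?thesis
    by (simp add: gw_space_def subtree_def [abs_def])
qed

text \<open>An i.i.d. family reindexed along the injection \<open>w \<mapsto> i # w\<close> keeps
  its law.\<close>

lemma distr_subtree: "distr (gw_space p) (gw_space p) (subtree i) = gw_space p"
proof -
  have "distr (\<Pi>\<^sub>M v\<in>UNIV. measure_pmf p) (\<Pi>\<^sub>M v\<in>UNIV. measure_pmf p) (\<lambda>\<omega>. \<lambda>w\<in>UNIV. \<omega> (i # w))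
      = (\<Pi>\<^sub>M v\<in>UNIV. measure_pmf p)"
    by (rule distr_PiM_reindex) (auto intro: measure_pmf.prob_space_axioms)
  then show ?thesis
    by (simp add: gw_space_def subtree_def [abs_def] restrict_def)
qed

lemma gw_P_subtree:
  assumes [measurable]: "Measurable.pred (gw_space p) B"
  shows "gw_P p (\<lambda>\<omega>. B (subtree i \<omega>)) = gw_P p B"
proof -
  have "gw_P p B = measure (distr (gw_space p) (gw_space p) (subtree i)) {\<omega>. B \<omega>}"
    by (simp add: distr_subtree)
  also have "\<dots> = gw_P p (\<lambda>\<omega>. B (subtree i \<omega>))"
    using assms by (subst measure_distr) (auto simp: vimage_def pred_def)
  finally show ?thesis ..
qed

lemma distr_eval: "distr (gw_space p) (measure_pmf p) (\<lambda>\<omega>. \<omega> v) = measure_pmf p"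
proof -
  interpret product_prob_space "\<lambda>_::vertex. measure_pmf p" UNIV
    by unfold_locales
  show ?thesis
    unfolding gw_space_def by (rule PiM_component) simp
qed

lemma gw_P_root: "gw_P p (\<lambda>\<omega>. \<omega> [] = k) = pmf p k"
proof -
  have "pmf p k = measure (distr (gw_space p) (measure_pmf p) (\<lambda>\<omega>. \<omega> [])) {k}"
    by (simp add: measure_pmf_single distr_eval)
  also have "\<dots> = gw_P p (\<lambda>\<omega>. \<omega> [] = k)"
    by (subst measure_distr) (auto simp: vimage_def cong: measurable_cong_sets)
  finally show ?thesis ..
qed

text \<open>The root label and the subtrees at distinct indices depend on disjoint blocks of
  independent coordinates.\<close>

lemma gw_P_root_subtrees:
  assumes B: "Measurable.pred (gw_space p) B"
  shows "gw_P p (\<lambda>\<omega>. \<omega> [] = k \<and> (\<forall>i<k. B (subtree i \<omega>))) = pmf p k * gw_P p B ^ k"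
proof -
  interpret prob_space "gw_space p" by (rule prob_space_gw_space)
  \<comment> \<open>Block 0 is the root and block \<open>Suc i\<close> the coordinates below child
    \<open>i\<close>; hence the shift by one, and the index set \<open>{..k}\<close> for
    \<open>k\<close> children.\<close>
  define K :: "nat \<Rightarrow> vertex set" where
    "K j = (case j of 0 \<Rightarrow> {[]} | Suc i \<Rightarrow> range ((#) i))" for j
  define A where "A j = (case j of 0 \<Rightarrow> {f \<in> space (\<Pi>\<^sub>M v\<in>K j. measure_pmf p). f [] = k}
    | Suc i \<Rightarrow> {f \<in> space (\<Pi>\<^sub>M v\<in>K j. measure_pmf p). B (\<lambda>w. f (i # w))})" for j
  define X where "X j \<omega> = restrict \<omega> (K j)" for j and \<omega> :: "vertex \<Rightarrow> nat"
  \<comment> \<open>Independence of the coordinates: their joint law is the product of the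
    marginals.\<close>
  have "indep_vars (\<lambda>_. measure_pmf p) (\<lambda>v \<omega>. \<omega> v) UNIV"
  proof (subst indep_vars_iff_distr_eq_PiM)
    have "distr (gw_space p) (measure_pmf p) (\<lambda>\<omega>. \<omega> v) = measure_pmf p" for v
      by (rule distr_eval)
    then show "distr (gw_space p) (\<Pi>\<^sub>M v\<in>UNIV. measure_pmf p) (\<lambda>\<omega>. \<lambda>v\<in>UNIV. \<omega> v)
        = (\<Pi>\<^sub>M v\<in>UNIV. distr (gw_space p) (measure_pmf p) (\<lambda>\<omega>. \<omega> v))"
      by (simp add: gw_space_def restrict_def)
  qed (auto cong: measurable_cong_sets)
  then have "indep_vars (\<lambda>j. \<Pi>\<^sub>M v\<in>K j. measure_pmf p) X UNIV"
    unfolding X_def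
    by (rule indep_vars_restrict) (auto simp: K_def disjoint_family_on_def split: nat.splits)
  then have ind: "prob (\<Inter>j\<in>{..k}. X j -` A j \<inter> space (gw_space p)) =
      (\<Prod>j\<in>{..k}. prob (X j -` A j \<inter> space (gw_space p)))"
  proof (rule indep_varsD)
    fix j
    show "A j \<in> sets (\<Pi>\<^sub>M v\<in>K j. measure_pmf p)"
    proof (cases j)
      case 0
      have "(\<lambda>f. f []) \<in> (\<Pi>\<^sub>M v\<in>K j. measure_pmf p) \<rightarrow>\<^sub>M measure_pmf p"
        by (rule measurable_component_singleton) (simp add: K_def 0)
      then have "(\<lambda>f. f []) \<in> (\<Pi>\<^sub>M v\<in>K j. measure_pmf p) \<rightarrow>\<^sub>M count_space UNIV"
        by (simp cong: measurable_cong_sets)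
      then show ?thesis
        unfolding A_def 0 by simp
    next
      case (Suc i)
      have "(\<lambda>f w. f (i # w)) \<in> (\<Pi>\<^sub>M v\<in>K j. measure_pmf p) \<rightarrow>\<^sub>M gw_space p"
        unfolding gw_space_def
      proof (rule measurable_PiM_single')
        fix w :: vertex
        show "(\<lambda>f. f (i # w)) \<in> (\<Pi>\<^sub>M v\<in>K j. measure_pmf p) \<rightarrow>\<^sub>M measure_pmf p"
          by (rule measurable_component_singleton) (simp add: K_def Suc)
      qed simp
      from measurable_compose[OF this B] show ?thesis
        unfolding A_def Suc by (simp add: pred_def)
    qed
  qed auto
  define Y where "Y j = X j -` A j \<inter> space (gw_space p)" for j
  have Y0: "Y 0 = {\<omega>. \<omega> [] = k}"
    by (auto simp: Y_def X_def A_def K_def space_PiM)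
  have YS: "Y (Suc i) = {\<omega>. B (subtree i \<omega>)}" for i
    by (auto simp: Y_def X_def A_def K_def space_PiM subtree_def)
  have "{\<omega>. \<omega> [] = k \<and> (\<forall>i<k. B (subtree i \<omega>))} = (\<Inter>j\<in>{..k}. Y j)"
    unfolding lessThan_Suc_atMost [symmetric] lessThan_Suc_eq_insert_0
    by (auto simp: Y0 YS)
  also have "prob \<dots> = (\<Prod>j<Suc k. prob (Y j))"
    using ind by (simp only: Y_def lessThan_Suc_atMost)
  also have "\<dots> = pmf p k * gw_P p B ^ k"
    unfolding prod.lessThan_Suc_shift by (simp add: Y0 YS gw_P_root gw_P_subtree[OF B])
  finally show ?thesis .
qed

text \<open>Splitting by the number of children of the root yields the series of \<open>G\<close>; a
  childless root satisfies the event vacuously and contributes the constant term.\<close>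

lemma gw_P_all_subtrees:
  assumes B [measurable]: "Measurable.pred (gw_space p) B"
  shows "gw_P p (\<lambda>\<omega>. \<forall>i<\<omega> []. B (subtree i \<omega>)) = gen_G p (gw_P p B)"
proof -
  interpret prob_space "gw_space p" by (rule prob_space_gw_space)
  let ?E = "\<lambda>k. {\<omega>. \<omega> [] = k \<and> (\<forall>i<k. B (subtree i \<omega>))}"
  have "?E k = {\<omega> \<in> space (gw_space p). \<omega> [] = k \<and> (\<forall>i<k. B (subtree i \<omega>))}" for k
    by simp
  moreover have "{\<omega> \<in> space (gw_space p). \<omega> [] = k \<and> (\<forall>i\<in>{..<k}. B (subtree i \<omega>))} \<in> events" for k
    by measurable
  ultimately have E: "?E k \<in> events" for k
    by (simp add: Ball_def)
  have "(\<lambda>k. prob (?E k)) sums prob (\<Union>k. ?E k)"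
    by (rule finite_measure_UNION) (use E in \<open>auto simp: disjoint_family_on_def\<close>)
  moreover have "(\<Union>k. ?E k) = {\<omega>. \<forall>i<\<omega> []. B (subtree i \<omega>)}"
    by auto
  ultimately show ?thesis
    by (simp add: gw_P_root_subtrees[OF B] gen_G_def sums_iff)
qed

section \<open>One move of the game in terms of generating functions\<close>

lemma pred_forces [measurable]: "Measurable.pred (gw_space p) (forces W own n)"
proof (induction n arbitrary: own)
  case (Suc n)
  note Suc.IH [measurable]
  have "Measurable.pred (gw_space p) (\<lambda>\<omega>.
      if \<omega> [] = 0 then W own
      else if own then \<exists>i. i < \<omega> [] \<and> forces W False n (subtree i \<omega>)
      else \<forall>i. i < \<omega> [] \<longrightarrow> forces W True n (subtree i \<omega>))"
    by measurable
  then show ?case by (simp add: forces.simps [abs_def])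
qed (simp add: forces.simps [abs_def])

lemma pred_wins [measurable]: "Measurable.pred (gw_space p) (wins W own)"
  unfolding wins_def [abs_def] by simp

text \<open>Common form of \<open>F\<close> (for \<open>b = False\<close>) and \<open>H\<close> (for
  \<open>b = True\<close>), so that all three games are handled together.\<close>

definition fun_K :: "nat pmf \<Rightarrow> bool \<Rightarrow> real \<Rightarrow> real" where
  "fun_K p b x = 1 - gen_G p x + (if b then pmf p 0 else 0)"

lemma gw_P_not:
  assumes "Measurable.pred (gw_space p) B"
  shows "gw_P p (\<lambda>\<omega>. \<not> B \<omega>) = 1 - gw_P p B"
proof -
  interpret prob_space "gw_space p" by (rule prob_space_gw_space)
  show ?thesis
    using prob_neg[of B] assms by (simp add: pred_def)
qed

text \<open>Some child satisfies \<open>B\<close> unless all children violate it, which has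
  probability \<open>G\<close> at \<open>1 - gw_P p B\<close>. The bounded existential fails at a
  childless root, so that case adds a disjoint \<open>pmf p 0\<close> when \<open>b\<close>
  holds.\<close>

lemma gw_P_own_step:
  assumes B [measurable]: "Measurable.pred (gw_space p) B"
  shows "gw_P p (\<lambda>\<omega>. if \<omega> [] = 0 then b else \<exists>i<\<omega> []. B (subtree i \<omega>)) = fun_K p b (1 - gw_P p B)"
proof -
  interpret prob_space "gw_space p" by (rule prob_space_gw_space)
  let ?L = "\<lambda>\<omega>. \<exists>i<\<omega> []. B (subtree i \<omega>)"
  have [measurable]: "Measurable.pred (gw_space p) ?L" by measurable
  have L: "gw_P p ?L = fun_K p False (1 - gw_P p B)"
    using gw_P_not[where p = p and B = "\<lambda>\<omega>. \<forall>i<\<omega> []. \<not> B (subtree i \<omega>)"] gw_P_all_subtrees[where p = p and B = "\<lambda>\<omega>. \<not> B \<omega>"]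
    by (simp add: gw_P_not[OF B] fun_K_def)
  show ?thesis
  proof (cases b)
    case True
    have "{\<omega>. if \<omega> [] = 0 then b else ?L \<omega>} = {\<omega>. ?L \<omega>} \<union> {\<omega>. \<omega> [] = 0}"
      using True by auto
    moreover have "prob \<dots> = gw_P p ?L + gw_P p (\<lambda>\<omega>. \<omega> [] = 0)"
    proof (rule finite_measure_Union)
      have "{\<omega> \<in> space (gw_space p). ?L \<omega>} \<in> events" by measurable
      then show "{\<omega>. ?L \<omega>} \<in> events" by simp
      have "{\<omega> \<in> space (gw_space p). \<omega> [] = 0} \<in> events" by measurable
      then show "{\<omega>. \<omega> [] = 0} \<in> events" by simp
    qed auto
    ultimately show ?thesis
      using True L by (simp add: gw_P_root fun_K_def)
  next
    case False
    then have "{\<omega>. if \<omega> [] = 0 then b else ?L \<omega>} = {\<omega>. ?L \<omega>}" by auto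
    with False L show ?thesis by simp
  qed
qed

text \<open>The opponent's turn is an own turn for the complementary event, whence
  \<open>\<not> b\<close>.\<close>

lemma gw_P_opp_step:
  assumes B [measurable]: "Measurable.pred (gw_space p) B"
  shows "1 - gw_P p (\<lambda>\<omega>. if \<omega> [] = 0 then b else \<forall>i<\<omega> []. B (subtree i \<omega>)) = fun_K p (\<not> b) (gw_P p B)"
proof -
  have eq: "(\<lambda>\<omega>. if \<omega> [] = 0 then \<not> b else \<exists>i<\<omega> []. \<not> B (subtree i \<omega>)) =
      (\<lambda>\<omega>. \<not> (if \<omega> [] = 0 then b else \<forall>i<\<omega> []. B (subtree i \<omega>)))"
    by auto
  have "gw_P p (\<lambda>\<omega>. if \<omega> [] = 0 then \<not> b else \<exists>i<\<omega> []. \<not> B (subtree i \<omega>)) = fun_K p (\<not> b) (1 - (1 - gw_P p B))"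
    by (subst gw_P_own_step) (simp_all add: gw_P_not[OF B])
  then show ?thesis
    unfolding eq by (subst (asm) gw_P_not) simp_all
qed

section \<open>Extremal fixed points\<close>

lemma summable_gen_G:
  assumes "x \<in> {0..1}"
  shows "summable (\<lambda>i. pmf p i * x ^ i)"
proof (rule summable_comparison_test')
  show "summable (pmf p)"
    using pmf_abs_summable[of p UNIV] by (simp add: abs_summable_on_nat_iff')
  show "norm (pmf p i * x ^ i) \<le> pmf p i" for i
    using assms by (simp add: abs_mult mult_left_le power_le_one)
qed

lemma gen_G_mono:
  assumes "0 \<le> x" "x \<le> y" "y \<le> 1"
  shows "gen_G p x \<le> gen_G p y"
  unfolding gen_G_def
  using assms by (intro suminf_le summable_gen_G mult_left_mono power_mono) auto

lemma fun_K_antimono: "0 \<le> x \<Longrightarrow> x \<le> y \<Longrightarrow> y \<le> 1 \<Longrightarrow> fun_K p b y \<le> fun_K p b x"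
  by (simp add: fun_K_def gen_G_mono)

lemma fun_K_bounds:
  assumes "x \<in> {0..1}"
  shows "fun_K p b x \<in> {0..1}"
proof -
  \<comment> \<open>With monotonicity of \<open>G\<close>, this keeps \<open>H\<close> below
    1.\<close>
  have "gen_G p 0 = pmf p 0"
    unfolding gen_G_def by (subst suminf_finite[of "{0}"]) auto
  \<comment> \<open>Normalisation comes from applying the branching identity to the sure
    event.\<close>
  moreover have "gen_G p 1 = 1"
    using gw_P_all_subtrees[where p = p and B = "\<lambda>_. True"] prob_space.prob_space[OF prob_space_gw_space, of p]
    by simp
  ultimately show ?thesis
    using gen_G_mono[of 0 x p] gen_G_mono[of x 1 p] assms pmf_nonneg[of p 0]
    by (auto simp: fun_K_def simp del: pmf_nonneg)
qed

text \<open>One kind of player, described by \<open>W\<close>, is followed in both seats: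
  \<open>M\<close> is the chance of winning as first mover, \<open>Q\<close> the chance of not
  winning as second mover. These two numbers form a closed recursion.\<close>

lemma game_value:
  assumes M: "M = gw_P p (wins W True)" and Q: "Q = 1 - gw_P p (wins W False)"
  shows "M = min_FP (fun_K p (W True) \<circ> fun_K p (\<not> W False))"
    and "Q = max_FP (fun_K p (\<not> W False) \<circ> fun_K p (W True))"
proof -
  interpret prob_space "gw_space p" by (rule prob_space_gw_space)
  let ?A = "fun_K p (W True)" and ?B = "fun_K p (\<not> W False)"
  define m where "m n = gw_P p (forces W True n)" for n
  define q where "q n = 1 - gw_P p (forces W False n)" for n
  have m_Suc: "m (Suc n) = ?A (q n)" for n
    using gw_P_own_step[where p = p and B = "forces W False n" and b = "W True"] by (simp add: m_def q_def cong: if_cong split del: if_split)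
  have q_Suc: "q (Suc n) = ?B (m n)" for n
    using gw_P_opp_step[where p = p and B = "forces W True n" and b = "W False"] by (simp add: m_def q_def cong: if_cong split del: if_split)
  have bounds: "m n \<in> {0..1}" "q n \<in> {0..1}" "M \<in> {0..1}" "Q \<in> {0..1}" for n
    by (auto simp: m_def q_def M Q)
  \<comment> \<open>The fixed point equations come from \<open>wins_iff\<close> itself, not from a
    limit of the recursion.\<close>
  have M_eq: "M = ?A Q"
    using gw_P_own_step[where p = p and B = "wins W False" and b = "W True"]
    unfolding M Q by (subst wins_iff[abs_def]) (simp cong: if_cong split del: if_split)
  have Q_eq: "Q = ?B M"
    using gw_P_opp_step[where p = p and B = "wins W True" and b = "W False"]
    unfolding M Q by (subst wins_iff[abs_def]) (simp cong: if_cong split del: if_split)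
  have M_lim: "m \<longlonglongrightarrow> M"
  proof -
    have "(\<lambda>n. prob {\<omega>. forces W True n \<omega>}) \<longlonglongrightarrow> prob (\<Union>n. {\<omega>. forces W True n \<omega>})"
    proof (rule finite_Lim_measure_incseq)
      show "incseq (\<lambda>n. {\<omega>. forces W True n \<omega>})"
        by (auto simp: incseq_def intro: forces_mono)
      have "{\<omega> \<in> space (gw_space p). forces W True n \<omega>} \<in> events" for n
        by measurable
      then show "range (\<lambda>n. {\<omega>. forces W True n \<omega>}) \<subseteq> events" by auto
    qed
    moreover have "(\<Union>n. {\<omega>. forces W True n \<omega>}) = {\<omega>. wins W True \<omega>}"
      by (auto simp: wins_def)
    ultimately show ?thesis by (simp add: m_def [abs_def] M)
  qed
  have least: "M \<le> x" if x: "x \<in> FP (?A \<circ> ?B)" for x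
  proof -
    from x have x01: "x \<in> {0..1}" and fp: "?A (?B x) = x" by (auto simp: FP_def)
    note Bx = fun_K_bounds[OF x01, of p "\<not> W False"]
    \<comment> \<open>The bounds on \<open>m\<close> and \<open>q\<close> must be proved together,
      since each antitone map turns one into the other.\<close>
    have "m n \<le> x \<and> ?B x \<le> q n" for n
    proof (induction n)
      case 0
      show ?case using x01 Bx by (simp add: m_def q_def)
    next
      case (Suc n)
      have "m (Suc n) \<le> ?A (?B x)"
        unfolding m_Suc using Suc Bx bounds(2)[of n] by (intro fun_K_antimono) auto
      moreover have "?B x \<le> q (Suc n)"
        unfolding q_Suc using Suc x01 bounds(1)[of n] by (intro fun_K_antimono) auto
      ultimately show ?case by (simp add: fp)
    qed
    with M_lim show ?thesis by (intro LIMSEQ_le_const2) auto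
  qed
  show "M = min_FP (?A \<circ> ?B)"
    unfolding min_FP_def
    by (rule Least_equality [symmetric]) (use M_eq Q_eq bounds(3) least in \<open>auto simp: FP_def\<close>)
  \<comment> \<open>\<open>?A\<close> carries \<open>y\<close> to a fixed point of
    \<open>?A \<circ> ?B\<close>, which lies above \<open>M\<close>; applying the antitone
    \<open>?B\<close> reverses the inequality. So only the limit of \<open>m\<close> is
    taken.\<close>
  have greatest: "y \<le> Q" if y: "y \<in> FP (?B \<circ> ?A)" for y
  proof -
    from y have y01: "y \<in> {0..1}" and fp: "?B (?A y) = y" by (auto simp: FP_def)
    note Ay = fun_K_bounds[OF y01, of p "W True"]
    then have "M \<le> ?A y"
      by (intro least) (simp add: FP_def fp)
    then have "?B (?A y) \<le> ?B M"
      using Ay bounds(3) by (intro fun_K_antimono) auto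
    with fp Q_eq show ?thesis by simp
  qed
  show "Q = max_FP (?B \<circ> ?A)"
    unfolding max_FP_def
    by (rule Greatest_equality [symmetric]) (use M_eq Q_eq bounds(4) greatest in \<open>auto simp: FP_def\<close>)
qed

section \<open>The normal, misere and escape games as instances\<close>

lemma fun_F_eq: "fun_F p = fun_K p False"
  by (simp add: fun_F_def [abs_def] fun_K_def [abs_def])

lemma fun_H_eq: "fun_H p = fun_K p True"
  by (simp add: fun_H_def [abs_def] fun_K_def [abs_def])

text \<open>For the first mover, an own turn is a turn of \<open>First\<close>; this rewrites the
  set \<open>A\<close> as a turn-relative condition.\<close>

lemma wins_First:
  assumes "\<And>T. Q T = can_force First A T"
  shows "Q (gw_tree \<omega>) \<longleftrightarrow> wins (\<lambda>own. (if own then First else Second) \<in> A) True \<omega>"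
proof -
  have "(if a = First then First else Second) = a" for a by (cases a) auto
  then show ?thesis
    using can_force_iff[of "\<lambda>own. (if own then First else Second) \<in> A" First A \<omega>] assms by simp
qed

lemma wins_Second:
  assumes "\<And>T. Q T = can_force Second A T"
  shows "Q (gw_tree \<omega>) \<longleftrightarrow> wins (\<lambda>own. (if own then Second else First) \<in> A) False \<omega>"
proof -
  have "(if a = Second then Second else First) = a" for a by (cases a) auto
  then show ?thesis
    using can_force_iff[of "\<lambda>own. (if own then Second else First) \<in> A" Second A \<omega>] assms by simp
qed

lemma gw_prob_first:
  assumes "\<And>T. Q T = can_force First A T"
  shows "gw_prob p Q = gw_P p (wins (\<lambda>own. (if own then First else Second) \<in> A) True)"
  by (simp add: gw_prob_def wins_First[OF assms])

lemma gw_prob_second: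
  assumes "\<And>T. Q T = can_force Second A T"
  shows "gw_prob p Q = gw_P p (wins (\<lambda>own. (if own then Second else First) \<in> A) False)"
  by (simp add: gw_prob_def wins_Second[OF assms])

text \<open>If both players could force a win, playing the two strategies against each other would
  end with a stuck player in \<open>A\<close> and in \<open>B\<close>, and by
  \<open>stuck_unique\<close> the same one. So the two wins are disjoint events.\<close>

lemma gw_prob_draw:
  assumes Q1: "\<And>T. Q1 T = can_force First A T" and Q2: "\<And>T. Q2 T = can_force Second B T"
    and "A \<inter> B = {}" and R: "\<And>T. R T \<longleftrightarrow> \<not> Q1 T \<and> \<not> Q2 T"
  shows "gw_prob p R = 1 - gw_prob p Q1 - gw_prob p Q2"
proof -
  interpret prob_space "gw_space p" by (rule prob_space_gw_space)
  let ?E = "\<lambda>Q. {\<omega>. Q (gw_tree \<omega>)}"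
  have Q1_iff: "Q1 (gw_tree \<omega>) = wins (\<lambda>own. (if own then First else Second) \<in> A) True \<omega>" for \<omega>
    by (rule wins_First[OF Q1])
  have Q2_iff: "Q2 (gw_tree \<omega>) = wins (\<lambda>own. (if own then Second else First) \<in> B) False \<omega>" for \<omega>
    by (rule wins_Second[OF Q2])
  have "{\<omega> \<in> space (gw_space p). Q1 (gw_tree \<omega>)} \<in> events"
    unfolding Q1_iff by measurable
  moreover have "{\<omega> \<in> space (gw_space p). Q2 (gw_tree \<omega>)} \<in> events"
    unfolding Q2_iff by measurable
  ultimately have ev: "?E Q1 \<in> events" "?E Q2 \<in> events" by simp_all
  have disj: "?E Q1 \<inter> ?E Q2 = {}"
  proof -
    have False if "can_force First A T" "can_force Second B T" for T
      using that \<open>A \<inter> B = {}\<close> unfolding can_force_def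
      by simp (metis IntI empty_iff stuck_unique)
    then show ?thesis by (auto simp: Q1 Q2)
  qed
  have "?E R = space (gw_space p) - (?E Q1 \<union> ?E Q2)"
    by (auto simp: R)
  then have "prob (?E R) = 1 - prob (?E Q1 \<union> ?E Q2)"
    using ev by (simp only: prob_compl sets.Un)
  also have "prob (?E Q1 \<union> ?E Q2) = prob (?E Q1) + prob (?E Q2)"
    by (rule finite_measure_Union) (use ev disj in auto)
  finally show ?thesis by (simp add: gw_prob_def)
qed

text \<open>In either seat a player loses when stuck on an own turn and wins when the opponent is
  stuck, so \<open>Not\<close> serves both Next and Previous. The other games likewise need a single
  \<open>W\<close> each.\<close>

lemma gw_prob_normal_next: "gw_prob p normal_next = gw_P p (wins (\<lambda>own. \<not> own) True)"
  by (subst gw_prob_first[of _ "{Second}"])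
    (auto simp: normal_next_def first_can_force_def can_force_def)

lemma gw_prob_normal_previous: "gw_prob p normal_previous = gw_P p (wins (\<lambda>own. \<not> own) False)"
  by (subst gw_prob_second[of _ "{First}"])
    (auto simp: normal_previous_def second_can_force_def can_force_def)

lemma gw_prob_misere_next: "gw_prob p misere_next = gw_P p (wins (\<lambda>own. own) True)"
  by (subst gw_prob_first[of _ "{First}"])
    (auto simp: misere_next_def first_can_force_def can_force_def)

lemma gw_prob_misere_previous: "gw_prob p misere_previous = gw_P p (wins (\<lambda>own. own) False)"
  by (subst gw_prob_second[of _ "{Second}"])
    (auto simp: misere_previous_def second_can_force_def can_force_def)

lemma gw_prob_stopper_first: "gw_prob p stopper_wins_first = gw_P p (wins (\<lambda>own. True) True)"
  by (subst gw_prob_first[of _ UNIV])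
    (auto simp: stopper_wins_first_def first_can_force_def can_force_def)

lemma gw_prob_stopper_second: "gw_prob p stopper_wins_second = gw_P p (wins (\<lambda>own. True) False)"
  by (subst gw_prob_second[of _ UNIV])
    (auto simp: stopper_wins_second_def second_can_force_def can_force_def)

theorem theorem1:
  fixes p :: "nat pmf"
  shows "(prob_D p = max_FP (fun_F p \<circ> fun_F p) - min_FP (fun_F p \<circ> fun_F p) \<and>
          prob_N p = min_FP (fun_F p \<circ> fun_F p) \<and>
          prob_P p = 1 - max_FP (fun_F p \<circ> fun_F p)) \<and>
         (misere_D p = max_FP (fun_H p \<circ> fun_H p) - min_FP (fun_H p \<circ> fun_H p) \<and>
          misere_N p = min_FP (fun_H p \<circ> fun_H p) \<and>
          misere_P p = 1 - max_FP (fun_H p \<circ> fun_H p)) \<and>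
         (escaper_E1 p = max_FP (fun_F p \<circ> fun_H p) \<and>
          escaper_E2 p = 1 - min_FP (fun_H p \<circ> fun_F p))"
proof -
  interpret prob_space "gw_space p" by (rule prob_space_gw_space)
  note val = game_value[OF refl refl, of p]
  \<comment> \<open>The two maps of \<open>game_value\<close> are both \<open>F\<close> for
    \<open>Not\<close>, both \<open>H\<close> for the identity, and \<open>H\<close> followed by
    \<open>F\<close> in the order of its statement for constant truth.\<close>
  have N: "prob_N p = min_FP (fun_F p \<circ> fun_F p)" and P: "1 - prob_P p = max_FP (fun_F p \<circ> fun_F p)"
    using val[of Not]
    by (simp_all add: prob_N_def prob_P_def gw_prob_normal_next gw_prob_normal_previous fun_F_eq)
  have mN: "misere_N p = min_FP (fun_H p \<circ> fun_H p)" and mP: "1 - misere_P p = max_FP (fun_H p \<circ> fun_H p)"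
    using val[of "\<lambda>own. own"]
    by (simp_all add: misere_N_def misere_P_def gw_prob_misere_next gw_prob_misere_previous fun_H_eq)
  have S1: "stopper_S1 p = min_FP (fun_H p \<circ> fun_F p)" and S2: "1 - stopper_S2 p = max_FP (fun_F p \<circ> fun_H p)"
    using val[of "\<lambda>_. True"]
    by (simp_all add: stopper_S1_def stopper_S2_def gw_prob_stopper_first gw_prob_stopper_second
        fun_H_eq fun_F_eq)
  have D: "prob_D p = 1 - prob_N p - prob_P p"
    unfolding prob_D_def prob_N_def prob_P_def
    by (rule gw_prob_draw[of _ "{Second}" _ "{First}"])
      (auto simp: normal_draw_def normal_next_def normal_previous_def
        first_can_force_def second_can_force_def can_force_def)
  have mD: "misere_D p = 1 - misere_N p - misere_P p"
    unfolding misere_D_def misere_N_def misere_P_def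
    by (rule gw_prob_draw[of _ "{First}" _ "{Second}"])
      (auto simp: misere_draw_def misere_next_def misere_previous_def
        first_can_force_def second_can_force_def can_force_def)
  show ?thesis
    using N P mN mP S1 S2 D mD by (simp add: escaper_E1_def escaper_E2_def)
qed

end
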